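(* For any $m,n\in\mathbb N$, the underlying set of the $m$-Fuss-Catalan easterly wind poset of order $n$ is in one-to-one correspondence with the set of $m$-trees of degree $n$, and the map $\mathrm{if}\circ\mathrm{bt}$ is such a one-to-one correspondence.
   Context: A signature is a set with an arity map to $\mathbb N$; view $\mathbb N$ as the signature where $k$ has arity $k$, and let $\mathbb N_{\mathbb N}=\mathbb N\sqcup\mathbb N$ (a disjoint copy of $\mathbb N$, again with $k$ of arity $k$). For a signature $S$, an $S$-term is either the leaf $\ell$ or $s\,t_1\cdots t_{|s|}$ with $s\in S$ and $S$-terms $t_i$ (an ordered rooted tree whose internal nodes with $k$ children are decorated by arity-$k$ elements); $T(S)$ denotes the set of $S$-terms; the degree is the number of internal nodes. Internal nodes are numbered in preorder (root, then subterms left to right); $\mathrm{dc}(t)$ is the decoration word; the parent edge of node $i$ is $(\mathrm{pa}(i),\mathrm{lp}(i),i)$ with $i$ the $\mathrm{lp}(i)$-th child (leaves counted) of $\mathrm{pa}(i)$, and $\mathrm{pa}(1)=1,\mathrm{lp}(1)=0$; $\mathrm{cnc}(t)(i)=\mathrm{pa}(i)+1-2^{\mathrm{lp}(i)-a}$ with $a$ the arity of the decoration of $\mathrm{pa}(i)$; $t_1\preceq t_2$ iff $\mathrm{dc}(t_1)=\mathrm{dc}(t_2)$ and $\mathrm{cnc}(t_1)\le\mathrm{cnc}(t_2)$ componentwise. The corolla $c(s)=s\,\ell\cdots\ell$; $F\bullet u$ replaces the leftmost leaf of $F$ by $u$. For a word $w=w_1\cdots w_n$ on $\mathbb N$: $\mathbf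 f^{\uparrow}(w)=n\,c(w_1)\cdots c(w_n)$ and $\mathbf f^{\downarrow}(w)=(\cdots(c(n)\bullet c(w_1))\cdots)\bullet c(w_n)$, where the root symbol $n$ is from the copy of $\mathbb N$. The $m$-Fuss-Catalan easterly wind poset of order $n$ is the set of $\mathbb N_{\mathbb N}$-terms $F$ with $\mathbf f^{\uparrow}(m^n)\preceq F\preceq\mathbf f^{\downarrow}(m^n)$ ($m^n$ the word with $n$ letters $m$). An $m$-tree is an element of $T(\{m+1\})$ (all internal nodes labelled $m+1$, of arity $m+1$). An $m$-binary tree is an element of $T(T(\{m\}))$ where every element of $T(\{m\})$ (an $(m-1)$-tree) is given arity $2$. For an $(m-1)$-tree $U$ of degree $k\ge1$, its right comb is the $m$-binary tree whose root is decorated by $U$, whose first child is a leaf and whose second child is a right comb of $k-1$ internal nodes each decorated by the leaf $\ell\in T(\{m\})$ (so it has $k$ internal nodes and $k+1$ leaves). The map $\mathrm{bt}$ from $m$-trees to $m$-binary trees: $\mathrm{bt}(\ell)=\ell$; otherwise let $U$ be the $(m-1)$-tree obtained from $t$ by keeping the root and recursively deleting the first subterm of every kept internal node, let $T_1,\dots,T_k$ ($k=\deg U$) be the deleted subterms from left to right, and let $R$ be the right comb of $U$; then $\mathrm{bt}(t)$ is obtained from $R$ by replacing, for each $i\in[k]$, the $i$-th leaf of $R$ by $\mathrm{bt}(T_i)$ (the last leaf stays). The inorder traversal of an $m$-binary tree $U\,R_1R_2$ visits $R_1$, then the root, then $R_2$ recursively. For an $m$-binary tree $R$ with $n$ internal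 nodes, $\mathrm{if}(R)$ is the $\mathbb N_{\mathbb N}$-term $n\,U_1\cdots U_n$ where $U_i$ is the decoration (an element of $T(\{m\})\subseteq T(\mathbb N)$) of the $i$-th internal node of $R$ in inorder. *)

theory Defs
  imports Complex_Main "HOL-Library.Equipollence"
begin

section \<open>Terms on a signature\<close>

text \<open>A signature is a set of symbols together with an arity map. The datatype contains the
  decorated trees with no constraint on arities; \<open>terms S ar\<close> is the set of terms on the
  signature \<open>(S, ar)\<close>.\<close>

datatype 's sterm = Leaf | Node 's "'s sterm list"

inductive_set terms :: "'s set \<Rightarrow> ('s \<Rightarrow> nat) \<Rightarrow> 's sterm set" for S :: "'s set" and ar :: "'s \<Rightarrow> nat"
where
  Leaf: "Leaf \<in> terms S ar"
| Node: "\<lbrakk>s \<in> S; length ts = ar s; \<forall>t\<in>set ts. t \<in> terms S ar\<rbrakk> \<Longrightarrow> Node s ts \<in> terms S ar"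

primrec deg :: "'s sterm \<Rightarrow> nat" where
  "deg Leaf = 0"
| "deg (Node s ts) = Suc (sum_list (map deg ts))"

text \<open>The decoration word, in preorder.\<close>

primrec dc :: "'s sterm \<Rightarrow> 's list" where
  "dc Leaf = []"
| "dc (Node s ts) = s # concat (map dc ts)"

text \<open>The addresses of the internal nodes, in preorder. An address is the list of the (1-based,
  leaves counted) child positions leading from the root to the node. Internal node number
  \<open>i\<close> (1-based) has address \<open>nodes t ! (i - 1)\<close> and decoration \<open>dc t ! (i - 1)\<close>.\<close>

primrec nodes :: "'s sterm \<Rightarrow> nat list list" where
  "nodes Leaf = []"
| "nodes (Node s ts) =
     [] # concat (map (\<lambda>(j, ps). map (Cons j) ps) (List.enumerate 1 (map nodes ts)))"

definition node_number :: "'s sterm \<Rightarrow> nat list \<Rightarrow> nat" where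
  "node_number t p = (THE i. i \<in> {1..deg t} \<and> nodes t ! (i - 1) = p)"

definition pa :: "'s sterm \<Rightarrow> nat \<Rightarrow> nat" where
  "pa t i = (if i = 1 then 1 else node_number t (butlast (nodes t ! (i - 1))))"

definition lp :: "'s sterm \<Rightarrow> nat \<Rightarrow> nat" where
  "lp t i = (if i = 1 then 0 else last (nodes t ! (i - 1)))"

text \<open>The connection word, as a function to be used on \<open>{1..deg t}\<close>.\<close>

definition cnc :: "('s \<Rightarrow> nat) \<Rightarrow> 's sterm \<Rightarrow> nat \<Rightarrow> rat" where
  "cnc ar t i =
     of_nat (pa t i) + 1 - 2 powi (int (lp t i) - int (ar (dc t ! (pa t i - 1))))"

definition ew_le :: "('s \<Rightarrow> nat) \<Rightarrow> 's sterm \<Rightarrow> 's sterm \<Rightarrow> bool" where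
  "ew_le ar t1 t2 \<longleftrightarrow> dc t1 = dc t2 \<and> (\<forall>i\<in>{1..deg t1}. cnc ar t1 i \<le> cnc ar t2 i)"

definition corolla :: "('s \<Rightarrow> nat) \<Rightarrow> 's \<Rightarrow> 's sterm" where
  "corolla ar s = Node s (replicate (ar s) Leaf)"

text \<open>\<open>graft_left t u\<close> replaces the leftmost leaf of \<open>t\<close> by \<open>u\<close>; a term without leaves (having
  nullary symbols only at its extremities) is left unchanged.\<close>

fun has_leaf :: "'s sterm \<Rightarrow> bool" where
  "has_leaf Leaf \<longleftrightarrow> True"
| "has_leaf (Node s ts) \<longleftrightarrow> (\<exists>t\<in>set ts. has_leaf t)"

fun graft_left :: "'s sterm \<Rightarrow> 's sterm \<Rightarrow> 's sterm"
  and graft_left_list :: "'s sterm list \<Rightarrow> 's sterm \<Rightarrow> 's sterm list" where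
  "graft_left Leaf u = u"
| "graft_left (Node s ts) u = Node s (graft_left_list ts u)"
| "graft_left_list [] u = []"
| "graft_left_list (t # ts) u =
     (if has_leaf t then graft_left t u # ts else t # graft_left_list ts u)"


section \<open>Fuss--Catalan easterly wind posets\<close>

text \<open>The signature of two disjoint copies of the natural numbers: \<open>Inl\<close> is the first copy
  (the letters), \<open>Inr\<close> is the second copy (the symbols used at the roots of forests).\<close>

definition arNN :: "nat + nat \<Rightarrow> nat" where
  "arNN = case_sum id id"

definition f_up :: "nat list \<Rightarrow> (nat + nat) sterm" where
  "f_up w = Node (Inr (length w)) (map (\<lambda>k. corolla arNN (Inl k)) w)"

definition f_down :: "nat list \<Rightarrow> (nat + nat) sterm" where
  "f_down w =
     foldl graft_left (corolla arNN (Inr (length w))) (map (\<lambda>k. corolla arNN (Inl k)) w)"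

text \<open>The underlying set of the \<open>m\<close>-Fuss--Catalan easterly wind poset of order \<open>n\<close>; its order
  relation is the restriction of \<open>ew_le arNN\<close>.\<close>

definition fuss_catalan_ew :: "nat \<Rightarrow> nat \<Rightarrow> (nat + nat) sterm set" where
  "fuss_catalan_ew m n =
     {F \<in> terms UNIV arNN. ew_le arNN (f_up (replicate n m)) F
                         \<and> ew_le arNN F (f_down (replicate n m))}"


section \<open>Trees and binary trees\<close>

definition m_trees :: "nat \<Rightarrow> nat sterm set" where
  "m_trees m = terms {m + 1} id"

definition m_binary_trees :: "nat \<Rightarrow> nat sterm sterm set" where
  "m_binary_trees m = terms (terms {m} id) (\<lambda>_. 2)"

text \<open>Keep the root and recursively delete the first subterm of every kept internal node. Each
  kept node loses a child, hence it is redecorated by \<open>m\<close> in place of \<open>m + 1\<close>.\<close>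

primrec trim :: "nat \<Rightarrow> nat sterm \<Rightarrow> nat sterm" where
  "trim m Leaf = Leaf"
| "trim m (Node s ts) = Node m (drop 1 (map (trim m) ts))"

text \<open>The subterms deleted by the previous operation, from left to right.\<close>

primrec deleted :: "'s sterm \<Rightarrow> 's sterm list" where
  "deleted Leaf = []"
| "deleted (Node s ts) = take 1 ts @ concat (drop 1 (map deleted ts))"

primrec leaf_comb :: "nat \<Rightarrow> 's sterm sterm" where
  "leaf_comb 0 = Leaf"
| "leaf_comb (Suc k) = Node Leaf [Leaf, leaf_comb k]"

definition right_comb :: "'s sterm \<Rightarrow> 's sterm sterm" where
  "right_comb U = Node U [Leaf, leaf_comb (deg U - 1)]"

primrec leaves :: "'s sterm \<Rightarrow> nat" where
  "leaves Leaf = 1"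
| "leaves (Node s ts) = sum_list (map leaves ts)"

text \<open>\<open>subst_leaves t [u\<^sub>1, \<dots>, u\<^sub>k]\<close> replaces the \<open>i\<close>-th leaf of \<open>t\<close>, from left to right, by
  \<open>u\<^sub>i\<close> for each \<open>i \<le> k\<close>; the other leaves stay.\<close>

fun subst_leaves :: "'s sterm \<Rightarrow> 's sterm list \<Rightarrow> 's sterm"
  and subst_leaves_list :: "'s sterm list \<Rightarrow> 's sterm list \<Rightarrow> 's sterm list" where
  "subst_leaves Leaf us = (case us of [] \<Rightarrow> Leaf | u # _ \<Rightarrow> u)"
| "subst_leaves (Node s ts) us = Node s (subst_leaves_list ts us)"
| "subst_leaves_list [] us = []"
| "subst_leaves_list (t # ts) us =
     subst_leaves t (take (leaves t) us) # subst_leaves_list ts (drop (leaves t) us)"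

lemma size_deleted: "u \<in> set (deleted t) \<Longrightarrow> size u < size t"
proof (induction t)
  case Leaf
  then show ?case by simp
next
  case (Node s ts)
  have size_child: "size v < size (Node s ts)" if "v \<in> set ts" for v
    using size_list_estimation'[of v ts "size v" size] that by simp
  from Node.prems consider "u \<in> set ts"
    | v where "v \<in> set ts" "u \<in> set (deleted v)"
    by (auto simp: drop_map dest: in_set_takeD in_set_dropD)
  then show ?case
  proof cases
    case 1
    then show ?thesis by (rule size_child)
  next
    case (2 v)
    with Node.IH have "size u < size v" by blast
    with size_child[OF 2(1)] show ?thesis by simp
  qed
qed

function bt :: "nat \<Rightarrow> nat sterm \<Rightarrow> nat sterm sterm" where
  "bt m Leaf = Leaf"
| "bt m (Node s ts) =
     subst_leaves (right_comb (trim m (Node s ts))) (map (bt m) (deleted (Node s ts)))"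
  by pat_completeness auto
termination
  by (relation "measure (\<lambda>(m, t). size t)") (simp_all add: size_deleted del: deleted.simps sterm.size)

lemma terms_subst_leaves:
  "t \<in> terms S ar \<Longrightarrow> set us \<subseteq> terms S ar \<Longrightarrow> subst_leaves t us \<in> terms S ar"
  "set ts \<subseteq> terms S ar \<Longrightarrow> set us \<subseteq> terms S ar \<Longrightarrow>
     set (subst_leaves_list ts us) \<subseteq> terms S ar \<and> length (subst_leaves_list ts us) = length ts"
proof (induction t us and ts us rule: subst_leaves_subst_leaves_list.induct)
  case (1 us)
  then show ?case by (auto split: list.split)
next
  case (2 s ts us)
  from "2.prems"(1) have *: "s \<in> S" "length ts = ar s" "set ts \<subseteq> terms S ar"
    by (auto elim: terms.cases)
  with "2.IH" "2.prems"(2) show ?case by (auto intro!: terms.Node)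
next
  case (3 us)
  then show ?case by simp
next
  case (4 t ts us)
  have "set (take (leaves t) us) \<subseteq> terms S ar" "set (drop (leaves t) us) \<subseteq> terms S ar"
    using 4(4) set_take_subset[of "leaves t" us] set_drop_subset[of "leaves t" us] by blast+
  with 4(1,2,3) show ?case by simp
qed

lemma trim_in_terms: "t \<in> m_trees m \<Longrightarrow> trim m t \<in> terms {m} id"
  unfolding m_trees_def
  by (induction t rule: terms.induct)
     (auto intro!: terms.intros simp: drop_map dest!: in_set_dropD)

lemma deleted_in_m_trees: "t \<in> m_trees m \<Longrightarrow> set (deleted t) \<subseteq> m_trees m"
  unfolding m_trees_def
  by (induction t rule: terms.induct)
     (auto simp: drop_map subset_iff dest: in_set_dropD in_set_takeD)

lemma leaf_comb_in_m_binary_trees: "leaf_comb k \<in> m_binary_trees m"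
  unfolding m_binary_trees_def by (induction k) (auto intro!: terms.intros)

lemma bt_in_m_binary_trees: "t \<in> m_trees m \<Longrightarrow> bt m t \<in> m_binary_trees m"
proof (induction t rule: measure_induct_rule[where f = size])
  case (less t)
  show ?case
  proof (cases t)
    case Leaf
    then show ?thesis by (simp add: m_binary_trees_def terms.Leaf)
  next
    case (Node s ts)
    have "right_comb (trim m t) \<in> m_binary_trees m"
      using trim_in_terms[OF less.prems] leaf_comb_in_m_binary_trees
      by (auto simp: m_binary_trees_def right_comb_def intro!: terms.intros)
    moreover have "set (map (bt m) (deleted t)) \<subseteq> m_binary_trees m"
      using less.IH size_deleted deleted_in_m_trees[OF less.prems] by auto
    ultimately show ?thesis
      unfolding Node bt.simps(2) m_binary_trees_def by (rule terms_subst_leaves(1))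
  qed
qed

text \<open>The decorations in inorder; only binary internal nodes are meaningful.\<close>

fun inorder :: "'s sterm \<Rightarrow> 's list" where
  "inorder Leaf = []"
| "inorder (Node U [R1, R2]) = inorder R1 @ U # inorder R2"

text \<open>The map denoted by \<open>if\<close> in the literature; \<open>map_sterm Inl\<close> is the inclusion of the terms
  on the natural numbers into the terms on the two copies.\<close>

definition iforest :: "nat sterm sterm \<Rightarrow> (nat + nat) sterm" where
  "iforest R = Node (Inr (deg R)) (map (map_sterm Inl) (inorder R))"

end

theory Submission
  imports Defs
begin

text \<open>The image of \<open>if\<close> \<open>\<circ>\<close> \<open>bt\<close> and the wind poset are both described by words \<open>U\<^sub>1 \<dots> U\<^sub>n\<close> of
  \<open>(m - 1)\<close>-trees of total degree \<open>n\<close>. In the poset, the upper bound \<open>f_down\<close> imposes nothing, because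
  there every node is the first child of its predecessor (or, for \<open>m = 0\<close>, because both bounds
  coincide); the lower bound \<open>f_up\<close> says that \<open>deg U\<^sub>1 + \<dots> + deg U\<^sub>j \<ge> j\<close> for all \<open>j\<close>.

  On the side of trees, if \<open>t\<close> has kept part \<open>U\<close> and deleted subterms \<open>T\<^sub>1, \<dots>, T\<^sub>k\<close>, then its inorder
  word is \<open>w(t) = w(T\<^sub>1) U w(T\<^sub>2) \<ell> \<dots> w(T\<^sub>k) \<ell>\<close>. A forest is coded by the concatenation of the words
  \<open>w(T) \<ell>\<close> of its trees, and is recovered by reading its code from the right: a letter \<open>\<ell>\<close> adds
  an empty tree in front of the forest, and a letter \<open>U\<close> of degree \<open>k \<ge> 1\<close> takes the first \<open>k - 1\<close> trees
  as \<open>T\<^sub>2, \<dots>, T\<^sub>k\<close> of a new node with empty \<open>T\<^sub>1\<close>, and grafts this node on the leftmost leaf of the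
  next tree. The condition on the degrees says exactly that enough trees are always available.\<close>

subsection \<open>Trees from kept part and deleted subterms\<close>

text \<open>These are the (m - 1)-trees; for \<open>m = 0\<close> only \<open>Leaf\<close> and
  \<open>Node 0 []\<close> remain.\<close>

definition ary_trees :: "nat \<Rightarrow> nat sterm set" where
  "ary_trees m = terms {m} id"

lemma ary_trees_Leaf: "Leaf \<in> ary_trees m"
  unfolding ary_trees_def by (rule terms.Leaf)

lemma ary_trees_Node:
  "Node s ts \<in> ary_trees m \<longleftrightarrow> s = m \<and> length ts = m \<and> set ts \<subseteq> ary_trees m"
  unfolding ary_trees_def by (auto elim: terms.cases intro: terms.Node)

lemma m_trees_Leaf: "Leaf \<in> m_trees m"
  unfolding m_trees_def by (rule terms.Leaf)

lemma m_trees_Node: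
  "Node s ts \<in> m_trees m \<longleftrightarrow> s = Suc m \<and> length ts = Suc m \<and> set ts \<subseteq> m_trees m"
  unfolding m_trees_def by (auto elim: terms.cases intro: terms.Node)

lemma m_trees_cases:
  assumes "t \<in> m_trees m" "t \<noteq> Leaf"
  obtains u us where "t = Node (Suc m) (u # us)" "u \<in> m_trees m" "set us \<subseteq> m_trees m"
    "length us = m"
proof (cases t)
  case (Node s ts)
  with assms(1) that show ?thesis
    by (cases ts) (auto simp: m_trees_Node)
qed (use assms in simp)

lemma m_trees_induct [consumes 1, case_names Leaf Node]:
  assumes "t \<in> m_trees m"
    and "P Leaf"
    and "\<And>u us. \<lbrakk>u \<in> m_trees m; set us \<subseteq> m_trees m; length us = m; P u; \<And>v. v \<in> set us \<Longrightarrow> P v\<rbrakk>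
      \<Longrightarrow> P (Node (Suc m) (u # us))"
  shows "P t"
  using assms(1)
proof (induction t)
  case Leaf
  show ?case by fact
next
  case (Node s ts)
  obtain u us where t: "Node s ts = Node (Suc m) (u # us)" and *: "u \<in> m_trees m"
    "set us \<subseteq> m_trees m" "length us = m"
    using m_trees_cases[OF Node.prems] by blast
  then show ?case
    using Node.IH assms(3)[of u us] by auto
qed

lemma length_concat_map: "length (concat (map f xs)) = (\<Sum>x\<leftarrow>xs. length (f x))"
  by (induction xs) auto

text \<open>Every kept node loses exactly one child, its first.\<close>

lemma length_deleted: "t \<in> m_trees m \<Longrightarrow> length (deleted t) = deg (trim m t)"
proof (induction rule: m_trees_induct)
  case (Node u us)
  have "(\<Sum>v\<leftarrow>us. length (deleted v)) = (\<Sum>v\<leftarrow>us. deg (trim m v))"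
    using Node by (intro arg_cong[where f = sum_list] map_cong) auto
  then show ?case by (simp add: length_concat_map comp_def)
qed simp

text \<open>Each internal node is either kept or lies in exactly one deleted subterm.\<close>

lemma deg_trim_deleted:
  "t \<in> m_trees m \<Longrightarrow> deg t = deg (trim m t) + sum_list (map deg (deleted t))"
proof (induction rule: m_trees_induct)
  case (Node u us)
  have "map deg us = map (\<lambda>v. deg (trim m v) + sum_list (map deg (deleted v))) us"
    using Node by simp
  then have "sum_list (map deg us) =
      (\<Sum>v\<leftarrow>us. deg (trim m v)) + (\<Sum>v\<leftarrow>us. sum_list (map deg (deleted v)))"
    by (simp only: sum_list_addf)
  moreover have "sum_list (map deg (concat (map deleted us))) =
      (\<Sum>v\<leftarrow>us. sum_list (map deg (deleted v)))"
    by (induction us) auto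
  ultimately show ?case by (simp add: comp_def)
qed simp

lemma trim_eq_Leaf_iff: "trim m t = Leaf \<longleftrightarrow> t = Leaf"
  by (cases t) auto

text \<open>Each node of \<open>U\<close> gets back a first child; \<open>deleted\<close> lists
  these children in preorder of the kept nodes, so \<open>Ts\<close> is consumed in that
  order.\<close>

lemma untrim_exists:
  assumes "U \<in> ary_trees m" "set Ts \<subseteq> m_trees m" "length Ts = deg U"
  shows "\<exists>t\<in>m_trees m. trim m t = U \<and> deleted t = Ts"
  using assms
proof (induction U arbitrary: Ts)
  case Leaf
  then show ?case using m_trees_Leaf by force
next
  case (Node s us)
  from Node.prems(1) have s: "s = m" "length us = m" "\<forall>u\<in>set us. u \<in> ary_trees m"
    by (auto simp: ary_trees_Node)
  from Node.prems(3) obtain T Rs where Ts: "Ts = T # Rs" "length Rs = sum_list (map deg us)"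
    by (cases Ts) auto
  \<comment> \<open>The remaining list is cut into consecutive blocks, one for each child
    \<open>u\<close>, of length \<open>deg u\<close>.\<close>
  have "\<exists>ts. set ts \<subseteq> m_trees m \<and> map (trim m) ts = us \<and> concat (map deleted ts) = Rs"
    if "set Rs \<subseteq> m_trees m" "length Rs = sum_list (map deg us)" for Rs
    using that s(3) Node.IH
  proof (induction us arbitrary: Rs)
    case Nil
    then show ?case by (intro exI[of _ "[]"]) simp
  next
    case (Cons u us)
    have *: "set (take (deg u) Rs) \<subseteq> m_trees m" "set (drop (deg u) Rs) \<subseteq> m_trees m"
      using Cons.prems(1) set_take_subset[of "deg u" Rs] set_drop_subset[of "deg u" Rs] by blast+
    obtain t where t: "t \<in> m_trees m" "trim m t = u" "deleted t = take (deg u) Rs"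
      using Cons.prems(4)[of u "take (deg u) Rs"] * Cons.prems(2,3) by auto
    obtain ts where ts: "set ts \<subseteq> m_trees m" "map (trim m) ts = us"
        "concat (map deleted ts) = drop (deg u) Rs"
      using Cons.IH[of "drop (deg u) Rs"] * Cons.prems by auto
    show ?case using t ts by (intro exI[of _ "t # ts"]) simp
  qed
  from this[of Rs] obtain ts where "set ts \<subseteq> m_trees m" "map (trim m) ts = us"
      "concat (map deleted ts) = Rs"
    using Ts Node.prems(2) by auto
  moreover from this(2) s(2) have "length ts = m"
    by (auto dest: map_eq_imp_length_eq)
  ultimately show ?case
    using s Ts Node.prems(2)
    by (intro bexI[of _ "Node (Suc m) (T # ts)"]) (auto simp: m_trees_Node)
qed

lemma untrim_unique:
  assumes "t \<in> m_trees m" "t' \<in> m_trees m" "trim m t = trim m t'" "deleted t = deleted t'"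
  shows "t = t'"
  using assms
proof (induction arbitrary: t' rule: m_trees_induct)
  case Leaf
  then show ?case by (metis trim_eq_Leaf_iff)
next
  case (Node u us)
  have "t' \<noteq> Leaf" using Node.prems(2) by auto
  with Node.prems(1) obtain u' us' where t': "t' = Node (Suc m) (u' # us')" "set us' \<subseteq> m_trees m"
    "length us' = m"
    by (rule m_trees_cases)
  have "us = us'"
    if "map (trim m) us = map (trim m) us'"
      "concat (map deleted us) = concat (map deleted us')"
    using that t'(2) Node(2) Node.IH(2)
  proof (induction us arbitrary: us')
    case (Cons v vs)
    then obtain v' vs' where [simp]: "us' = v' # vs'" by auto
    \<comment> \<open>Equal kept parts give equal lengths, so the two concatenations split at the
      same place.\<close>
    have "length (deleted v) = length (deleted v')"
      using Cons.prems by (auto simp: length_deleted)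
    with Cons.prems have "deleted v = deleted v'" "concat (map deleted vs) = concat (map deleted vs')"
      by auto
    with Cons show ?case by auto
  qed simp
  with Node.prems t' show ?case by auto
qed

subsection \<open>The inorder word of a binary tree\<close>

definition code :: "nat \<Rightarrow> nat sterm \<Rightarrow> nat sterm list" where
  "code m t = inorder (bt m t)"

definition codes :: "nat \<Rightarrow> nat sterm list \<Rightarrow> nat sterm list" where
  "codes m Ts = concat (map (\<lambda>T. code m T @ [Leaf]) Ts)"

lemma codes_simps [simp]:
  "codes m [] = []"
  "codes m (T # Ts) = code m T @ Leaf # codes m Ts"
  "codes m (Ss @ Ts) = codes m Ss @ codes m Ts"
  by (simp_all add: codes_def)

lemma leaves_leaf_comb [simp]: "leaves (leaf_comb k) = Suc k"
  by (induction k) auto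

text \<open>A comb node is visited just after its first subterm, so every \<open>R\<close> is
  followed by one \<open>Leaf\<close>; the last leaf of the comb stays and contributes
  nothing.\<close>

lemma inorder_subst_leaf_comb:
  "length Rs = k \<Longrightarrow>
    inorder (subst_leaves (leaf_comb k) Rs) = concat (map (\<lambda>R. inorder R @ [Leaf]) Rs)"
proof (induction k arbitrary: Rs)
  case (Suc k)
  then show ?case by (cases Rs) auto
qed simp

lemma code_Leaf [simp]: "code m Leaf = []"
  by (simp add: code_def)

lemma code_nonleaf:
  assumes "t \<in> m_trees m" "deleted t = T # Ts"
  shows "code m t = code m T @ trim m t # codes m Ts"
proof -
  obtain s ts where t: "t = Node s ts" using assms(2) by (cases t) auto
  have "bt m t = subst_leaves (right_comb (trim m t)) (map (bt m) (deleted t))"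
    by (simp add: t)
  then have "bt m t = Node (trim m t) [bt m T, subst_leaves (leaf_comb (length Ts)) (map (bt m) Ts)]"
    using length_deleted[OF assms(1), symmetric] assms(2) by (simp add: right_comb_def)
  then show ?thesis
    by (simp add: code_def codes_def inorder_subst_leaf_comb comp_def)
qed

section \<open>Grafting on the leftmost leaf\<close>

lemma has_leaf_m_trees: "t \<in> m_trees m \<Longrightarrow> has_leaf t"
  by (induction rule: m_trees_induct) auto

lemma graft_left_in_m_trees:
  "t \<in> m_trees m \<Longrightarrow> x \<in> m_trees m \<Longrightarrow> graft_left t x \<in> m_trees m"
  by (induction rule: m_trees_induct) (auto simp: m_trees_Node has_leaf_m_trees)

text \<open>The code of a tree begins with the code of its first child. Descending along first
  children, the empty code of the leftmost leaf stands at the very beginning, and it is replaced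
  there by the code of \<open>x\<close>.\<close>

lemma code_graft_left:
  assumes "t \<in> m_trees m" "x \<in> m_trees m" "deleted x = Leaf # Ts"
  shows "code m (graft_left t x) = trim m x # codes m Ts @ code m t"
  using assms
proof (induction rule: m_trees_induct)
  case Leaf
  then show ?case by (simp add: code_nonleaf)
next
  case (Node u us)
  let ?t = "Node (Suc m) (u # us)" and ?g = "Node (Suc m) (graft_left u x # us)"
  have "?t \<in> m_trees m" "?g \<in> m_trees m"
    using Node graft_left_in_m_trees by (auto simp: m_trees_Node)
  from this[THEN code_nonleaf] Node show ?case
    by (simp add: has_leaf_m_trees)
qed

text \<open>The tree \<open>x\<close> hangs at the last internal node of the leftmost branch, whose
  first child is a leaf. By \<open>code_graft_left\<close>, its kept part is the first letter of the
  code.\<close>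

lemma graft_left_decomposition:
  assumes "t \<in> m_trees m" "t \<noteq> Leaf"
  obtains S x Ts where "S \<in> m_trees m" "x \<in> m_trees m" "deleted x = Leaf # Ts"
    "t = graft_left S x"
proof -
  have "t \<noteq> Leaf \<longrightarrow> (\<exists>S\<in>m_trees m. \<exists>x\<in>m_trees m. \<exists>Ts. deleted x = Leaf # Ts \<and> t = graft_left S x)"
    using assms(1)
  proof (induction rule: m_trees_induct)
    case (Node u us)
    show ?case
    proof (cases "u = Leaf")
      case True
      then show ?thesis
        using Node
        by (intro impI bexI[of _ Leaf] bexI[of _ "Node (Suc m) (u # us)"])
           (auto simp: m_trees_Node m_trees_Leaf)
    next
      case False
      with Node obtain S x Ts where *: "S \<in> m_trees m" "x \<in> m_trees m" "deleted x = Leaf # Ts"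
        "u = graft_left S x" by blast
      with Node show ?thesis
        by (intro impI bexI[of _ "Node (Suc m) (S # us)"] bexI[of _ x])
           (auto simp: m_trees_Node has_leaf_m_trees)
    qed
  qed simp
  with assms(2) that show thesis by blast
qed

section \<open>Sparse words and decoding\<close>

text \<open>All nonempty suffixes of the word have total degree less than their length.\<close>

primrec sparse :: "'s sterm list \<Rightarrow> bool" where
  "sparse [] \<longleftrightarrow> True"
| "sparse (U # W) \<longleftrightarrow> sparse W \<and> deg U + sum_list (map deg W) \<le> length W"

text \<open>The word is read from the right. The surplus \<open>k\<close> of its length over its
  total degree is the number of trees available, and sparseness says that the surplus is positive
  after every letter.\<close>

lemma codes_exists:
  assumes "set W \<subseteq> ary_trees m" "sparse W" "sum_list (map deg W) + k = length W"
  shows "\<exists>L. set L \<subseteq> m_trees m \<and> length L = k \<and> codes m L = W"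
  using assms
proof (induction W arbitrary: k)
  case Nil
  then show ?case by (intro exI[of _ "[]"]) simp
next
  case (Cons U W)
  \<comment> \<open>Before \<open>U\<close> is read there are \<open>deg U + k - 1\<close> trees:
    the letter takes \<open>deg U\<close> of them away and puts one back.\<close>
  have "\<exists>L. set L \<subseteq> m_trees m \<and> length L = deg U + k - 1 \<and> codes m L = W"
    using Cons.prems by (intro Cons.IH) auto
  then obtain L where L: "set L \<subseteq> m_trees m" "length L = deg U + k - 1" "codes m L = W" by blast
  have k: "k > 0" using Cons.prems by auto
  show ?case
  proof (cases "U = Leaf")
    case True
    with L k show ?thesis by (intro exI[of _ "Leaf # L"]) (auto simp: m_trees_Leaf)
  next
    case False
    then obtain d where d: "deg U = Suc d" by (cases U) auto
    \<comment> \<open>\<open>A\<close> supplies the deleted subterms of the new node except the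
      first, which is \<open>Leaf\<close>; as \<open>k > 0\<close>, a tree \<open>S\<close> is left
      to be grafted on.\<close>
    define A where "A = take d L"
    have "drop d L \<noteq> []" using L k d by auto
    then obtain S Ss where S: "drop d L = S # Ss" by (cases "drop d L") auto
    have L': "L = A @ S # Ss" unfolding A_def by (metis S append_take_drop_id)
    have lenA: "length A = d" using L k d by (simp add: A_def)
    obtain x where x: "x \<in> m_trees m" "trim m x = U" "deleted x = Leaf # A"
      using untrim_exists[of U m "Leaf # A"] L(1) Cons.prems(1) lenA d
      by (auto simp: L' m_trees_Leaf)
    show ?thesis
    proof (intro exI[of _ "graft_left S x # Ss"] conjI)
      show "set (graft_left S x # Ss) \<subseteq> m_trees m"
        using L(1) x by (auto simp: L' intro: graft_left_in_m_trees)
      show "length (graft_left S x # Ss) = k"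
        using L(2) lenA d k by (auto simp: L')
      show "codes m (graft_left S x # Ss) = U # W"
        using code_graft_left[of S m x A] L(1,3) x by (auto simp: L')
    qed
  qed
qed

text \<open>The decoding is forced: the first letter shows which operation came last, and its degree
  shows how many trees that operation used.\<close>

lemma codes_unique:
  assumes "set L \<subseteq> m_trees m" "set L' \<subseteq> m_trees m" "codes m L = codes m L'"
    "length L = length L'"
  shows "L = L'"
  using assms
proof (induction "codes m L" arbitrary: L L')
  case Nil
  then show ?case by (cases L; cases L') auto
next
  case (Cons U W)
  \<comment> \<open>Undoes the last operation: either an empty tree was put in front, or a node with
    empty first subterm was grafted on \<open>S\<close>.\<close>
  have first_letter: "L = Leaf # K \<and> U = Leaf \<and> W = codes m K \<or>
      (\<exists>S x A. L = graft_left S x # K \<and> U \<noteq> Leaf \<and> S \<in> m_trees m \<and> x \<in> m_trees m \<and>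
        deleted x = Leaf # A \<and> trim m x = U \<and> W = codes m (A @ S # K))"
    if L: "L = T # K" "set L \<subseteq> m_trees m" "U # W = codes m L" for L T K
  proof (cases "T = Leaf")
    case False
    obtain S x A where *: "S \<in> m_trees m" "x \<in> m_trees m" "deleted x = Leaf # A"
      "T = graft_left S x"
      using graft_left_decomposition[of T m] L(1,2) False by auto
    have "x \<noteq> Leaf" using *(3) by auto
    with * L(1,3) code_graft_left[OF *(1,2,3)] show ?thesis
      by (auto simp: trim_eq_Leaf_iff)
  qed (use L in auto)
  obtain T K T' K' where LL: "L = T # K" "L' = T' # K'"
    using Cons.hyps(2) Cons.prems(3,4) by (cases L; cases L') auto
  show ?case
  proof (cases "U = Leaf")
    case True
    then have "L = Leaf # K" "W = codes m K" "L' = Leaf # K'" "W = codes m K'"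
      using first_letter[OF LL(1)] first_letter[OF LL(2)] Cons.prems Cons.hyps(2) by auto
    with Cons.hyps(1)[of K K'] Cons.prems show ?thesis by auto
  next
    case False
    obtain S x A where 1: "L = graft_left S x # K" "S \<in> m_trees m" "x \<in> m_trees m"
      "deleted x = Leaf # A" "trim m x = U" "W = codes m (A @ S # K)"
      using first_letter[OF LL(1)] False Cons.prems Cons.hyps(2) by auto
    obtain S' x' A' where 2: "L' = graft_left S' x' # K'" "S' \<in> m_trees m" "x' \<in> m_trees m"
      "deleted x' = Leaf # A'" "trim m x' = U" "W = codes m (A' @ S' # K')"
      using first_letter[OF LL(2)] False Cons.prems Cons.hyps(2) by auto
    \<comment> \<open>Both lengths are one less than \<open>deg U\<close>, so the two shorter
      forests can be compared and then split at the same place.\<close>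
    have len: "length A = length A'"
      using length_deleted[OF 1(3)] length_deleted[OF 2(3)] 1(4,5) 2(4,5) by auto
    have "set A \<subseteq> m_trees m" "set A' \<subseteq> m_trees m"
      using deleted_in_m_trees[OF 1(3)] deleted_in_m_trees[OF 2(3)] 1(4) 2(4) by auto
    moreover have "set K \<subseteq> m_trees m" "set K' \<subseteq> m_trees m" "length K = length K'"
      using Cons.prems(1,2,4) 1(1) 2(1) by simp_all
    ultimately have "A @ S # K = A' @ S' # K'"
      using 1(2) 2(2) len by (intro Cons.hyps(1)[OF 1(6) _ _ trans[OF 1(6)[symmetric] 2(6)]]) simp_all
    with len have "A = A'" "S = S'" "K = K'" by auto
    moreover have "x = x'" using 1(3-5) 2(3-5) \<open>A = A'\<close> by (simp add: untrim_unique)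
    ultimately show ?thesis using 1(1) 2(1) by simp
  qed
qed

text \<open>A nonempty code is not sparse by itself, since its total degree equals its length. The
  last clause therefore puts a word \<open>V\<close> of positive surplus behind it; in this form it
  passes to concatenations.\<close>

lemma code_sound:
  assumes "t \<in> m_trees m"
  shows "set (code m t) \<subseteq> ary_trees m \<and> length (code m t) = deg t \<and>
    sum_list (map deg (code m t)) = deg t \<and>
    (\<forall>V. sparse V \<longrightarrow> sum_list (map deg V) < length V \<longrightarrow> sparse (code m t @ V))"
  using assms
proof (induction t rule: measure_induct_rule[where f = size])
  case (less t)
  show ?case
  proof (cases "deleted t")
    case Nil
    then have "t = Leaf" using length_deleted[OF less.prems] by (cases t) auto
    then show ?thesis by simp
  next
    case (Cons T Ts)
    let ?d = "\<lambda>W. sum_list (map deg W)"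
    have IH: "set (code m u) \<subseteq> ary_trees m" "length (code m u) = deg u" "?d (code m u) = deg u"
        "sparse V \<Longrightarrow> ?d V < length V \<Longrightarrow> sparse (code m u @ V)" if "u \<in> set (T # Ts)" for u V
      using less.IH[OF size_deleted, of u] deleted_in_m_trees[OF less.prems] that Cons by auto
    \<comment> \<open>The same for forests, where each closing \<open>Leaf\<close> raises the
      surplus by one.\<close>
    have codes: "set (codes m Us) \<subseteq> ary_trees m \<and> length (codes m Us) = ?d Us + length Us \<and>
        ?d (codes m Us) = ?d Us \<and>
        (\<forall>V. sparse V \<longrightarrow> ?d V < length V \<longrightarrow> sparse (codes m Us @ V))"
      if "set Us \<subseteq> set (T # Ts)" for Us
      using that
    proof (induction Us)
      case (Cons u Us)
      then have u: "u \<in> set (T # Ts)" by simp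
      show ?case using Cons IH[OF u] by (auto intro: ary_trees_Leaf)
    qed simp
    \<comment> \<open>The kept part has degree one more than the surplus of
      \<open>codes m Ts\<close>, so prepending \<open>trim m t # codes m Ts\<close> to
      \<open>V\<close> leaves the surplus of \<open>V\<close> unchanged.\<close>
    have degs: "deg t = deg (trim m t) + deg T + ?d Ts" "Suc (length Ts) = deg (trim m t)"
      using deg_trim_deleted[OF less.prems] length_deleted[OF less.prems] Cons by auto
    show ?thesis
      using codes[OF set_subset_Cons] IH[of T] degs trim_in_terms[OF less.prems, folded ary_trees_def]
      by (auto simp: code_nonleaf[OF less.prems Cons])
  qed
qed

section \<open>Trees and their codes\<close>

lemma deg_binary_tree: "R \<in> terms S (\<lambda>_. 2) \<Longrightarrow> deg R = length (inorder R)"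
proof (induction rule: terms.induct)
  case (Node s ts)
  then obtain a b where "ts = [a, b]" by (auto simp: numeral_2_eq_2 length_Suc_conv)
  with Node show ?case by auto
qed simp

lemma iforest_bt:
  assumes "t \<in> m_trees m"
  shows "iforest (bt m t) = Node (Inr (deg t)) (map (map_sterm Inl) (code m t))"
  using deg_binary_tree bt_in_m_binary_trees[OF assms] code_sound[OF assms]
  unfolding iforest_def code_def m_binary_trees_def by metis

text \<open>Appending \<open>Leaf\<close> makes the code of a tree into that of a one-tree forest,
  to which \<open>codes_exists\<close> and \<open>codes_unique\<close> apply with surplus 1.\<close>

lemma bij_betw_code:
  "bij_betw (code m) {t \<in> m_trees m. deg t = n}
    {W. set W \<subseteq> ary_trees m \<and> length W = n \<and> sum_list (map deg W) = n \<and> sparse (W @ [Leaf])}"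
    (is "bij_betw _ ?T ?W")
proof (rule bij_betw_imageI)
  show "inj_on (code m) ?T"
  proof (rule inj_onI)
    fix t t' assume "t \<in> ?T" "t' \<in> ?T" "code m t = code m t'"
    then show "t = t'" using codes_unique[of "[t]" m "[t']"] by simp
  qed
  show "code m ` ?T = ?W"
  proof (intro equalityI subsetI)
    fix W assume W: "W \<in> ?W"
    have "\<exists>L. set L \<subseteq> m_trees m \<and> length L = 1 \<and> codes m L = W @ [Leaf]"
      using W by (intro codes_exists) (auto intro: ary_trees_Leaf)
    then obtain t where t: "t \<in> m_trees m" "code m t = W"
      by (auto simp: length_Suc_conv)
    with code_sound[of t m] W show "W \<in> code m ` ?T" by auto
  next
    fix W assume "W \<in> code m ` ?T"
    then obtain t where "t \<in> m_trees m" "deg t = n" "W = code m t" by auto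
    with code_sound[of t m] show "W \<in> ?W" by auto
  qed
qed

subsection \<open>Preorder numbering\<close>

text \<open>The variable starting position \<open>k\<close> permits induction on the list of
  subterms.\<close>

definition forest_nodes :: "nat \<Rightarrow> 's sterm list \<Rightarrow> nat list list" where
  "forest_nodes k ts = concat (map (\<lambda>(j, ps). map (Cons j) ps) (List.enumerate k (map nodes ts)))"

lemma forest_nodes_simps [simp]:
  "forest_nodes k [] = []"
  "forest_nodes k (t # ts) = map (Cons k) (nodes t) @ forest_nodes (Suc k) ts"
  by (simp_all add: forest_nodes_def)

lemma nodes_Node: "nodes (Node s ts) = [] # forest_nodes 1 ts"
  by (simp add: forest_nodes_def)

declare nodes.simps(2) [simp del] nodes_Node [simp]

lemma length_nodes [simp]: "length (nodes t) = deg t"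
proof (induction t)
  case (Node s ts)
  then have "length (forest_nodes k ts) = sum_list (map deg ts)" for k
    by (induction ts arbitrary: k) auto
  then show ?case by simp
qed simp

lemma length_dc [simp]: "length (dc t) = deg t"
proof (induction t)
  case (Node s ts)
  then have "length (concat (map dc ts)) = sum_list (map deg ts)"
    by (induction ts) auto
  then show ?case by simp
qed simp

lemma nodes_nth_0: "t \<noteq> Leaf \<Longrightarrow> nodes t ! 0 = []"
  by (cases t) auto

lemma deg_pos_iff: "0 < deg t \<longleftrightarrow> t \<noteq> Leaf"
  by (cases t) auto

lemma distinct_nodes: "distinct (nodes t)"
proof (induction t)
  case (Node s ts)
  have bound: "\<exists>j q. p = j # q \<and> k \<le> j" if "p \<in> set (forest_nodes k ts)" for p k and ts :: "'a sterm list"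
    using that
  proof (induction ts arbitrary: k)
    case (Cons t ts)
    then show ?case using Suc_leD by fastforce
  qed simp
  have "distinct (forest_nodes k ts)" for k
    using Node
  proof (induction ts arbitrary: k)
    case (Cons t ts)
    then show ?case
      using bound[of _ "Suc k" ts] by (fastforce simp: distinct_map)
  qed simp
  moreover have "[] \<notin> set (forest_nodes 1 ts)" using bound[of "[]"] by blast
  ultimately show ?case by simp
qed simp

lemma forest_index:
  assumes "i < sum_list (map deg ts)"
  obtains j r where "j < length ts" "r < deg (ts ! j)" "i = sum_list (map deg (take j ts)) + r"
proof -
  have "\<exists>j r. j < length ts \<and> r < deg (ts ! j) \<and> i = sum_list (map deg (take j ts)) + r"
    using assms
  proof (induction ts arbitrary: i)
    case (Cons t ts)
    show ?case
    proof (cases "i < deg t")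
      case True
      then show ?thesis by (intro exI[of _ 0] exI[of _ i]) simp
    next
      case False
      with Cons.prems have "i - deg t < sum_list (map deg ts)" by auto
      from Cons.IH[OF this] obtain j r where "j < length ts" "r < deg (ts ! j)"
        "i - deg t = sum_list (map deg (take j ts)) + r" by blast
      with False show ?thesis by (intro exI[of _ "Suc j"] exI[of _ r]) simp
    qed
  qed simp
  with that show thesis by blast
qed

lemma forest_nodes_nth:
  assumes "j < length ts" "r < deg (ts ! j)"
  shows "forest_nodes k ts ! (sum_list (map deg (take j ts)) + r) = (k + j) # nodes (ts ! j) ! r"
  using assms
proof (induction ts arbitrary: j k)
  case (Cons t ts)
  then show ?case by (cases j) (auto simp: nth_append)
qed simp

text \<open>The outer \<open>Suc\<close> skips the root, first in preorder; \<open>Suc j\<close>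
  appears because addresses count children from 1.\<close>

lemma nodes_nth:
  assumes "j < length ts" "r < deg (ts ! j)"
  shows "nodes (Node s ts) ! Suc (sum_list (map deg (take j ts)) + r) = Suc j # nodes (ts ! j) ! r"
  using forest_nodes_nth[OF assms] by simp

lemma dc_nth:
  assumes "j < length ts" "r < deg (ts ! j)"
  shows "dc (Node s ts) ! Suc (sum_list (map deg (take j ts)) + r) = dc (ts ! j) ! r"
proof -
  have "concat (map dc ts) ! (sum_list (map deg (take j ts)) + r) = dc (ts ! j) ! r"
    using assms
  proof (induction ts arbitrary: j)
    case (Cons t ts)
    then show ?case by (cases j) (auto simp: nth_append)
  qed simp
  then show ?thesis by simp
qed

section \<open>Parent edges and connection words\<close>

lemma parent_node:
  assumes "t \<in> terms S ar" "0 < i" "i < deg t"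
  shows "nodes t ! i \<noteq> [] \<and> (\<exists>i'<i. nodes t ! i' = butlast (nodes t ! i) \<and>
    1 \<le> last (nodes t ! i) \<and> last (nodes t ! i) \<le> ar (dc t ! i'))"
  using assms
proof (induction arbitrary: i rule: terms.induct)
  case (Node s ts)
  obtain i0 where i0: "i = Suc i0" "i0 < sum_list (map deg ts)"
    using Node.prems by (cases i) auto
  obtain j r where jr: "j < length ts" "r < deg (ts ! j)" "i0 = sum_list (map deg (take j ts)) + r"
    using forest_index[OF i0(2)] .
  note nth = nodes_nth[OF jr(1)] dc_nth[OF jr(1)]
  \<comment> \<open>For \<open>r = 0\<close> the node is the root of a subterm and its parent has
    index 0; otherwise the parent lies in the same subterm, by induction.\<close>
  show ?case
  proof (cases "r = 0")
    case True
    have "nodes (ts ! j) ! 0 = []" using jr(2) by (intro nodes_nth_0) auto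
    then have "nodes (Node s ts) ! i = [Suc j]"
      using nth(1)[OF jr(2), of s] True by (simp add: i0 jr(3))
    with jr(1) Node.hyps i0 show ?thesis by (intro conjI exI[of _ 0]) auto
  next
    case False
    have "ts ! j \<in> set ts" "0 < r" using jr(1) False by auto
    with Node.IH jr(2) obtain r' where r': "r' < r" "nodes (ts ! j) ! r \<noteq> []"
      "nodes (ts ! j) ! r' = butlast (nodes (ts ! j) ! r)"
      "1 \<le> last (nodes (ts ! j) ! r)" "last (nodes (ts ! j) ! r) \<le> ar (dc (ts ! j) ! r')"
      by blast
    have "r' < deg (ts ! j)" using r' jr by simp
    note nth' = nth[OF this, of s] nth[OF jr(2), of s]
    show ?thesis
      using r' by (intro conjI exI[of _ "Suc (sum_list (map deg (take j ts)) + r')"])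
        (simp_all only: i0 jr(3) nth', auto)
  qed
qed simp

lemma node_number_nth:
  assumes "i < deg t"
  shows "node_number t (nodes t ! i) = Suc i"
  unfolding node_number_def
proof (rule the_equality)
  fix i' assume "i' \<in> {1..deg t} \<and> nodes t ! (i' - 1) = nodes t ! i"
  then show "i' = Suc i"
    using nth_eq_iff_index_eq[OF distinct_nodes, of "i' - 1" t i] assms by auto
qed (use assms in auto)

text \<open>The last claim holds because the root is the only node with empty address.\<close>

lemma pa_lp_bounds:
  assumes "t \<in> terms S ar" "2 \<le> i" "i \<le> deg t"
  shows "1 \<le> pa t i" "pa t i < i" "1 \<le> lp t i" "lp t i \<le> ar (dc t ! (pa t i - 1))"
    "pa t i = 1 \<longleftrightarrow> nodes t ! (i - 1) = [lp t i]"
proof -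
  have *: "nodes t ! (i - 1) \<noteq> []" and "\<exists>i'<i - 1. nodes t ! i' = butlast (nodes t ! (i - 1)) \<and>
    1 \<le> last (nodes t ! (i - 1)) \<and> last (nodes t ! (i - 1)) \<le> ar (dc t ! i')"
    using parent_node[OF assms(1), of "i - 1"] assms by auto
  then obtain i' where i': "i' < i - 1" "nodes t ! i' = butlast (nodes t ! (i - 1))"
    "1 \<le> last (nodes t ! (i - 1))" "last (nodes t ! (i - 1)) \<le> ar (dc t ! i')" by blast
  have lp: "lp t i = last (nodes t ! (i - 1))" using assms by (simp add: lp_def)
  have pa: "pa t i = Suc i'"
    using assms i'(1) node_number_nth[of i' t] unfolding pa_def i'(2)[symmetric] by simp
  show "1 \<le> pa t i" "pa t i < i" "1 \<le> lp t i" "lp t i \<le> ar (dc t ! (pa t i - 1))"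
    using pa lp i' by auto
  have "t \<noteq> Leaf" "i' < deg t" "0 < deg t" using assms i'(1) by auto
  then have root: "i' = 0 \<longleftrightarrow> nodes t ! i' = []"
    using nodes_nth_0[of t] nth_eq_iff_index_eq[OF distinct_nodes, of i' t 0] by simp
  obtain p x where "nodes t ! (i - 1) = p @ [x]"
    using * by (cases "nodes t ! (i - 1)" rule: rev_cases) simp_all
  then show "pa t i = 1 \<longleftrightarrow> nodes t ! (i - 1) = [lp t i]"
    using root i'(2) by (simp add: pa lp)
qed

text \<open>The exponent is at most 0, so the subtracted power lies between 0 (excluded) and 1. Thus
  the integer part of a connection is the parent number, and parents are compared before
  positions.\<close>

lemma cnc_bounds:
  assumes "t \<in> terms S ar" "2 \<le> i" "i \<le> deg t"
  shows "of_nat (pa t i) \<le> cnc ar t i" "cnc ar t i < of_nat (pa t i) + 1"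
proof -
  have "(2 :: rat) powi (int (lp t i) - int (ar (dc t ! (pa t i - 1)))) \<le> 2 powi 0"
    using pa_lp_bounds(4)[OF assms] by (intro power_int_increasing) auto
  then show "of_nat (pa t i) \<le> cnc ar t i" by (simp add: cnc_def)
  show "cnc ar t i < of_nat (pa t i) + 1" by (simp add: cnc_def)
qed

lemma cnc_root_eq: "dc t = dc t' \<Longrightarrow> cnc ar t 1 = cnc ar t' 1"
  by (simp add: cnc_def pa_def lp_def)

lemma cnc_le_iff:
  assumes "dc t = dc t'" "pa t i = pa t' i"
  shows "cnc ar t i \<le> cnc ar t' i \<longleftrightarrow> lp t' i \<le> lp t i"
proof -
  have "(2 :: rat) powi a \<le> 2 powi b \<longleftrightarrow> a \<le> b" for a b :: int
    using power_int_increasing[of a b "2 :: rat"] power_int_strict_increasing[of b a "2 :: rat"]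
    by (cases "a \<le> b") auto
  with assms show ?thesis by (simp add: cnc_def)
qed

lemma deg_eq_if_dc_eq: "dc t = dc t' \<Longrightarrow> deg t = deg t'"
  by (metis length_dc)

text \<open>The predecessor is the largest possible parent, and for a given parent position 1 gives
  the largest connection.\<close>

lemma ew_le_left_comb:
  assumes "t \<in> terms S ar" "t' \<in> terms S ar" "dc t = dc t'"
    and "\<And>i. 2 \<le> i \<Longrightarrow> i \<le> deg t \<Longrightarrow> pa t' i = i - 1 \<and> lp t' i = 1"
  shows "ew_le ar t t'"
  unfolding ew_le_def
proof (intro conjI ballI)
  fix i assume i: "i \<in> {1..deg t}"
  show "cnc ar t i \<le> cnc ar t' i"
  proof (cases "i = 1")
    case False
    with i have i: "2 \<le> i" "i \<le> deg t" by auto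
    then have i': "i \<le> deg t'" using deg_eq_if_dc_eq[OF assms(3)] by simp
    note t = pa_lp_bounds[OF assms(1) i] cnc_bounds[OF assms(1) i]
    show ?thesis
    proof (cases "pa t i = i - 1")
      case True
      then show ?thesis using t assms(4)[OF i] by (simp add: cnc_le_iff[OF assms(3)])
    next
      case False
      with t have "pa t i + 1 \<le> pa t' i" using assms(4)[OF i] by simp
      then have "of_nat (pa t i) + 1 \<le> (of_nat (pa t' i) :: rat)"
        by (metis of_nat_1 of_nat_add of_nat_le_iff)
      then show ?thesis using t(7) cnc_bounds(1)[OF assms(2) i(1) i'] by linarith
    qed
  qed (use cnc_root_eq[OF assms(3), of ar] in simp)
qed (fact assms)

subsection \<open>The least and the greatest forest\<close>

lemma forest_nodes_replicate_Leaf [simp]: "forest_nodes k (replicate n Leaf) = []"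
  by (induction n arbitrary: k) auto

lemma concat_dc_replicate_Leaf [simp]: "concat (map dc (replicate n Leaf)) = []"
  by (induction n) auto

lemma f_up_replicate:
  "dc (f_up (replicate n m)) = Inr n # replicate n (Inl m)"
  "nodes (f_up (replicate n m)) = [] # map (\<lambda>j. [j]) [1..<Suc n]"
  "f_up (replicate n m) \<in> terms UNIV arNN"
proof -
  let ?c = "corolla arNN (Inl m)"
  have c: "dc ?c = [Inl m]" "nodes ?c = [[]]" "?c \<in> terms UNIV arNN"
    by (auto simp: corolla_def intro!: terms.intros)
  have "concat (map dc (replicate n ?c)) = replicate n (Inl m)"
    by (induction n) (auto simp: c)
  then show "dc (f_up (replicate n m)) = Inr n # replicate n (Inl m)"
    by (simp add: f_up_def)
  have "forest_nodes k (replicate n ?c) = map (\<lambda>j. [j]) [k..<k + n]" for k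
    by (induction n arbitrary: k) (auto simp: c upt_rec)
  then show "nodes (f_up (replicate n m)) = [] # map (\<lambda>j. [j]) [1..<Suc n]"
    by (simp add: f_up_def)
  show "f_up (replicate n m) \<in> terms UNIV arNN"
    using c by (auto simp: f_up_def arNN_def intro!: terms.intros)
qed

primrec left_chain :: "'s \<Rightarrow> nat \<Rightarrow> nat \<Rightarrow> 's sterm" where
  "left_chain s a 0 = Leaf"
| "left_chain s a (Suc k) = Node s (left_chain s a k # replicate a Leaf)"

lemma has_leaf_left_chain: "has_leaf (left_chain s a k)"
  by (induction k) auto

lemma graft_left_left_chain:
  "graft_left (left_chain s a k) (left_chain s a 1) = left_chain s a (Suc k)"
  by (induction k) (auto simp: has_leaf_left_chain)

lemma nodes_left_chain: "nodes (left_chain s a k) = map (\<lambda>j. replicate j 1) [0..<k]"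
  by (induction k) (simp_all add: upt_conv_Cons flip: map_Suc_upt replicate_Suc del: upt_Suc)

lemma dc_left_chain: "dc (left_chain s a k) = replicate k s"
  by (induction k) auto

lemma left_chain_in_terms:
  "s \<in> S \<Longrightarrow> ar s = Suc a \<Longrightarrow> left_chain s a k \<in> terms S ar"
  by (induction k) (auto intro!: terms.intros)

lemma f_down_replicate_Suc:
  "f_down (replicate (Suc n) (Suc a)) =
    Node (Inr (Suc n)) (left_chain (Inl (Suc a)) a (Suc n) # replicate n Leaf)"
proof -
  let ?l = "left_chain (Inl (Suc a)) a :: nat \<Rightarrow> (nat + nat) sterm"
  have "corolla arNN (Inl (Suc a)) = ?l 1"
    by (simp add: corolla_def arNN_def)
  \<comment> \<open>Generalised over the chain length \<open>k\<close>, which grows while the fold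
    runs.\<close>
  moreover have "foldl graft_left (Node r (?l k # replicate n Leaf)) (replicate j (?l 1)) =
      Node r (?l (k + j) # replicate n Leaf)" for r k j
    by (induction j arbitrary: k)
      (simp_all add: has_leaf_left_chain graft_left_left_chain del: One_nat_def left_chain.simps(2))
  from this[of "Inr (Suc n)" 0 "Suc n"] have
    "foldl graft_left (corolla arNN (Inr (Suc n))) (replicate (Suc n) (?l 1)) =
      Node (Inr (Suc n)) (?l (Suc n) # replicate n Leaf)"
    by (simp add: corolla_def arNN_def)
  ultimately show ?thesis by (simp add: f_down_def)
qed

text \<open>A nullary corolla has no leaf, so after each graft the leftmost leaf is the next child
  of the root and no chain forms.\<close>

lemma f_down_replicate_0: "f_down (replicate n 0) = f_up (replicate n 0)"
proof -
  let ?c = "Node (Inl 0) [] :: (nat + nat) sterm"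
  have g: "graft_left_list (replicate a ?c @ Leaf # ts) u = replicate a ?c @ u # ts" for a ts u
    by (induction a) auto
  have "foldl graft_left (Node r (replicate a ?c @ replicate b Leaf)) (replicate b ?c) =
      Node r (replicate (a + b) ?c)" for r a b
  proof (induction b arbitrary: a)
    case (Suc b)
    from Suc[of "Suc a"] show ?case
      by (simp add: g replicate_app_Cons_same)
  qed simp
  from this[of "Inr n" 0 n] show ?thesis
    by (simp add: f_down_def f_up_def corolla_def arNN_def)
qed

lemma f_down_Nil: "f_down [] = Node (Inr 0) []"
  by (simp add: f_down_def corolla_def arNN_def)

lemma ew_le_f_down_Suc:
  assumes "F \<in> terms UNIV arNN" "dc F = Inr n # replicate n (Inl (Suc a))"
  shows "ew_le arNN F (f_down (replicate n (Suc a)))" (is "ew_le _ _ ?d")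
proof (rule ew_le_left_comb)
  show d: "?d \<in> terms UNIV arNN"
    by (cases n)
      (auto simp: f_down_replicate_Suc f_down_Nil arNN_def
        simp del: left_chain.simps replicate_Suc intro!: terms.intros left_chain_in_terms)
  show dc: "dc F = dc ?d"
    by (cases n)
      (auto simp: assms f_down_replicate_Suc f_down_Nil arNN_def dc_left_chain
        simp del: left_chain.simps replicate_Suc)
  have nodes: "nodes ?d = map (\<lambda>j. replicate j 1) [0..<Suc n]"
    by (cases n)
      (simp_all add: f_down_replicate_Suc f_down_Nil arNN_def nodes_left_chain
        upt_conv_Cons flip: map_Suc_upt replicate_Suc del: upt_Suc left_chain.simps, simp)
  have deg: "deg ?d = Suc n" using arg_cong[OF nodes, of length] by simp
  fix i assume i: "2 \<le> i" "i \<le> deg F"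
  then have n: "i \<le> Suc n" using deg_eq_if_dc_eq[OF dc] deg by simp
  have nth: "nodes ?d ! j = replicate j 1" if "j < Suc n" for j
    using that by (simp add: nodes del: upt_Suc)
  \<comment> \<open>Addresses consist of ones only, so removing the last entry gives the address of
    the preceding node.\<close>
  have "butlast (nodes ?d ! (i - 1)) = nodes ?d ! (i - 2)"
    using i n by (simp add: nth butlast_conv_take)
  then show "pa ?d i = i - 1 \<and> lp ?d i = 1"
    using i n node_number_nth[of "i - 2" ?d] deg nth[of "i - 1"]
    by (simp add: pa_def lp_def last_replicate)
qed (fact assms)

text \<open>All nodes of \<open>f_up\<close> other than the root are children of the root, so the
  comparison restricts only the children of the root of the larger term.\<close>

lemma f_up_ew_le_iff:
  assumes "Node s ts \<in> terms UNIV arNN" "dc (Node s ts) = Inr n # replicate n (Inl m)"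
  shows "ew_le arNN (f_up (replicate n m)) (Node s ts) \<longleftrightarrow>
    (\<forall>j<length ts. ts ! j \<noteq> Leaf \<longrightarrow> j \<le> sum_list (map deg (take j ts)))"
    (is "ew_le _ ?u ?F \<longleftrightarrow> ?R")
proof -
  have dc: "dc ?u = dc ?F" using assms by (simp add: f_up_replicate)
  have deg: "deg ?F = Suc n" "deg ?u = Suc n"
    using arg_cong[OF assms(2), of length] deg_eq_if_dc_eq[OF dc] by (auto simp del: dc.simps)
  have nth: "nodes ?u ! (i - 1) = [i - 1]" if "2 \<le> i" "i \<le> Suc n" for i
  proof -
    obtain j where "i = 2 + j" using \<open>2 \<le> i\<close> by (auto dest: le_Suc_ex)
    with that show ?thesis by (simp add: f_up_replicate del: upt_Suc)
  qed
  have u: "pa ?u i = 1 \<and> lp ?u i = i - 1" if "2 \<le> i" "i \<le> Suc n" for i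
    using that nth[OF that] pa_lp_bounds(5)[OF f_up_replicate(3), of i n m] deg
    by (auto simp: lp_def)
  have "ew_le arNN ?u ?F \<longleftrightarrow> (\<forall>i\<in>{2..Suc n}. cnc arNN ?u i \<le> cnc arNN ?F i)"
  proof -
    have "{1..Suc n} = insert 1 {2..Suc n}" by auto
    then show ?thesis
      using cnc_root_eq[OF dc, of arNN] dc unfolding ew_le_def deg by simp
  qed
  \<comment> \<open>A node of \<open>?F\<close> whose parent is not the root has a larger integer
    part than in \<open>?u\<close> and passes; for a child of the root the positions are
    compared.\<close>
  also have "\<dots> \<longleftrightarrow> (\<forall>i\<in>{2..Suc n}. pa ?F i = 1 \<longrightarrow> lp ?F i \<le> i - 1)"
  proof (intro ball_cong refl)
    fix i assume "i \<in> {2..Suc n}"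
    then have i: "2 \<le> i" "i \<le> Suc n" by auto
    show "cnc arNN ?u i \<le> cnc arNN ?F i \<longleftrightarrow> (pa ?F i = 1 \<longrightarrow> lp ?F i \<le> i - 1)"
    proof (cases "pa ?F i = 1")
      case True
      then show ?thesis using u[OF i] cnc_le_iff[OF dc, of i arNN] by simp
    next
      case False
      then have "pa ?u i + 1 \<le> pa ?F i"
        using u[OF i] pa_lp_bounds(1)[OF assms(1) i(1)] i(2) deg by simp
      then have "of_nat (pa ?u i) + 1 \<le> (of_nat (pa ?F i) :: rat)"
        by (metis of_nat_1 of_nat_add of_nat_le_iff)
      moreover have "cnc arNN ?u i < of_nat (pa ?u i) + 1"
        using cnc_bounds(2)[OF f_up_replicate(3) i(1), of n m] i(2) deg by simp
      moreover have "of_nat (pa ?F i) \<le> cnc arNN ?F i"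
        using cnc_bounds(1)[OF assms(1) i(1)] i(2) deg by simp
      ultimately show ?thesis using False by simp
    qed
  qed
  also have "\<dots> \<longleftrightarrow> ?R"
  proof (intro iffI allI impI ballI)
    fix j assume *: "\<forall>i\<in>{2..Suc n}. pa ?F i = 1 \<longrightarrow> lp ?F i \<le> i - 1"
      and j: "j < length ts" "ts ! j \<noteq> Leaf"
    \<comment> \<open>This is the number of the root of \<open>ts ! j\<close>, counted from 1, after
      the root of the forest and all nodes of the earlier subterms.\<close>
    define i where "i = Suc (Suc (sum_list (map deg (take j ts))))"
    have "sum_list (map deg (take j ts)) < sum_list (map deg ts)"
    proof -
      have "ts = take j ts @ ts ! j # drop (Suc j) ts" using j(1) by (rule id_take_nth_drop)
      then have "sum_list (map deg ts) =
          sum_list (map deg (take j ts)) + deg (ts ! j) + sum_list (map deg (drop (Suc j) ts))"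
        by (metis add.assoc list.simps(9) map_append sum_list.Cons sum_list_append)
      then show ?thesis using j(2) deg_pos_iff[of "ts ! j"] by simp
    qed
    then have i: "2 \<le> i" "i \<le> deg ?F" by (auto simp: i_def)
    have "nodes ?F ! (i - 1) = [Suc j]"
      using nodes_nth[OF j(1), of 0 s] j(2) nodes_nth_0[OF j(2)]
      by (simp add: i_def deg_pos_iff del: nodes_Node)
    moreover from this have "lp ?F i = Suc j" using i by (simp add: lp_def del: nodes_Node)
    ultimately have "Suc j \<le> i - 1"
      using * i deg pa_lp_bounds(5)[OF assms(1) i] by (auto simp del: nodes_Node)
    then show "j \<le> sum_list (map deg (take j ts))" by (simp add: i_def)
  next
    fix i assume *: ?R and i: "i \<in> {2..Suc n}" "pa ?F i = 1"
    then have "2 \<le> i" by simp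
    have lp: "nodes ?F ! (i - 1) = [lp ?F i]"
      using pa_lp_bounds(5)[OF assms(1), of i] i deg by simp
    \<comment> \<open>Locates node \<open>i\<close> in a subterm; the two units removed are the root
      and the numbering from 1.\<close>
    have "i - 2 < sum_list (map deg ts)" using i deg by auto
    then obtain j r where jr: "j < length ts" "r < deg (ts ! j)"
      "i - 2 = sum_list (map deg (take j ts)) + r"
      by (rule forest_index)
    have "i - 1 = Suc (sum_list (map deg (take j ts)) + r)" using jr(3) i by auto
    then have "lp ?F i = Suc j" using lp nodes_nth[OF jr(1,2), of s] by (simp del: nodes_Node)
    moreover have "j \<le> sum_list (map deg (take j ts))" using * jr(1,2) by auto
    ultimately show "lp ?F i \<le> i - 1" using jr(3) \<open>2 \<le> i\<close> by linarith
  qed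
  finally show ?thesis .
qed

section \<open>Forests as words of trees\<close>

lemma deg_map_sterm [simp]: "deg (map_sterm f t) = deg t"
proof (induction t)
  case (Node s ts)
  then have "map (deg \<circ> map_sterm f) ts = map deg ts" by simp
  then show ?case by (simp del: map_eq_conv)
qed simp

lemma dc_map_sterm: "dc (map_sterm f t) = map f (dc t)"
proof (induction t)
  case (Node s ts)
  then have "map (dc \<circ> map_sterm f) ts = map (map f \<circ> dc) ts" by simp
  then show ?case by (simp add: map_concat del: map_eq_conv)
qed simp

lemma ary_trees_map_Inl:
  "t \<in> ary_trees m \<Longrightarrow> map_sterm Inl t \<in> terms UNIV arNN \<and> set (dc t) \<subseteq> {m}"
  unfolding ary_trees_def
  by (induction rule: terms.induct) (auto intro!: terms.intros simp: arNN_def)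

lemma ary_trees_map_Inl_exists:
  assumes "t \<in> terms UNIV arNN" "set (dc t) \<subseteq> {Inl m}"
  shows "\<exists>U\<in>ary_trees m. t = map_sterm Inl U"
  using assms
proof (induction rule: terms.induct)
  case Leaf
  then show ?case using ary_trees_Leaf by force
next
  case (Node s ts)
  have "\<forall>t\<in>set ts. \<exists>U\<in>ary_trees m. t = map_sterm Inl U" using Node by auto
  then obtain f where f: "\<And>t. t \<in> set ts \<Longrightarrow> f t \<in> ary_trees m \<and> t = map_sterm Inl (f t)"
    by metis
  then have "map (map_sterm Inl) (map f ts) = ts" by (simp add: map_idI)
  with Node f show ?case
    by (intro bexI[of _ "Node m (map f ts)"]) (auto simp: ary_trees_Node arNN_def)
qed

text \<open>With a single letter below the root, the decoration word records only the total
  degree.\<close>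

lemma dc_forest:
  assumes "set W \<subseteq> ary_trees m"
  shows "dc (Node s (map (map_sterm Inl) W)) = s # replicate (sum_list (map deg W)) (Inl m)"
proof -
  have "dc (map_sterm Inl U) = replicate (deg U) (Inl m)" if "U \<in> ary_trees m" for U
    using ary_trees_map_Inl[OF that]
    by (intro replicate_eqI) (auto simp: dc_map_sterm)
  with assms have "concat (map dc (map (map_sterm Inl) W)) =
      replicate (sum_list (map deg W)) (Inl m)"
    by (induction W) (auto simp: replicate_add)
  then show ?thesis by simp
qed

text \<open>The final \<open>Leaf\<close> lengthens each suffix by one at no cost in degree, which
  turns the strict bound into a weak one.\<close>

lemma sparse_snoc_Leaf_iff:
  "sparse (W @ [Leaf]) \<longleftrightarrow> (\<forall>j\<le>length W. sum_list (map deg (drop j W)) \<le> length W - j)"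
proof (induction W)
  case (Cons U W)
  have "(\<forall>j\<le>length (U # W). P j) \<longleftrightarrow> P 0 \<and> (\<forall>j\<le>length W. P (Suc j))" for P
    using All_less_Suc2[of "Suc (length W)" P] by (simp add: less_Suc_eq_le)
  with Cons show ?case by auto
qed simp

text \<open>As total degree and length agree, bounds on suffixes become bounds on the complementary
  prefixes. These need testing only in front of nonempty trees, as in
  \<open>f_up_ew_le_iff\<close>.\<close>

lemma sparse_iff_nonleaf:
  assumes "sum_list (map deg W) = length W"
  shows "sparse (W @ [Leaf]) \<longleftrightarrow>
    (\<forall>j<length W. W ! j \<noteq> Leaf \<longrightarrow> j \<le> sum_list (map deg (take j W)))"
proof -
  have split: "sum_list (map deg (take j W)) + sum_list (map deg (drop j W)) = length W" for j
    by (metis append_take_drop_id assms map_append sum_list_append)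
  have "sparse (W @ [Leaf]) \<longleftrightarrow> (\<forall>j\<le>length W. j \<le> sum_list (map deg (take j W)))"
    unfolding sparse_snoc_Leaf_iff
  proof (intro all_cong1 imp_cong refl)
    fix j assume "j \<le> length W"
    then show "sum_list (map deg (drop j W)) \<le> length W - j \<longleftrightarrow>
        j \<le> sum_list (map deg (take j W))"
      using split[of j] by linarith
  qed
  also have "\<dots> \<longleftrightarrow> (\<forall>j<length W. W ! j \<noteq> Leaf \<longrightarrow> j \<le> sum_list (map deg (take j W)))"
  proof (intro iffI allI impI)
    fix j assume *: "\<forall>j<length W. W ! j \<noteq> Leaf \<longrightarrow> j \<le> sum_list (map deg (take j W))"
      and "j \<le> length W"
    from this(2) show "j \<le> sum_list (map deg (take j W))"
    \<comment> \<open>Downward induction from the whole word: stepping back over a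
      \<open>Leaf\<close> keeps the prefix sum and lowers the bound.\<close>
    proof (induction rule: inc_induct)
      case base
      then show ?case using assms by simp
    next
      case (step j)
      then show ?case
        using * by (cases "W ! j = Leaf") (auto simp: take_Suc_conv_app_nth)
    qed
  qed auto
  finally show ?thesis .
qed

text \<open>For \<open>m = 0\<close> each tree has degree at most 1, so a total equal to the length
  leaves no room for \<open>Leaf\<close>.\<close>

lemma ary_trees_0_forest:
  assumes "set W \<subseteq> ary_trees 0" "sum_list (map deg W) = length W"
  shows "W = replicate (length W) (Node 0 [])"
proof -
  have U: "U = Leaf \<or> U = Node 0 []" if "U \<in> ary_trees 0" for U
    using that by (cases U) (auto simp: ary_trees_Node)
  have "sum_list (map deg W) \<le> length W \<and>
      (sum_list (map deg W) = length W \<longrightarrow> (\<forall>U\<in>set W. U = Node 0 []))"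
    using assms(1)
  proof (induction W)
    case (Cons V W)
    then show ?case using U[of V] by auto
  qed simp
  then show ?thesis using assms(2) by (intro replicate_eqI) auto
qed

lemma forest_in_fuss_catalan_ew_iff:
  assumes "set W \<subseteq> ary_trees m" "length W = n"
  shows "Node (Inr n) (map (map_sterm Inl) W) \<in> fuss_catalan_ew m n \<longleftrightarrow>
    sum_list (map deg W) = n \<and> sparse (W @ [Leaf])" (is "?F \<in> _ \<longleftrightarrow> _")
proof (cases "sum_list (map deg W) = n")
  case True
  have F: "?F \<in> terms UNIV arNN"
    using assms ary_trees_map_Inl by (fastforce simp: arNN_def intro!: terms.intros)
  have dc: "dc ?F = Inr n # replicate n (Inl m)"
    using dc_forest[OF assms(1)] True by simp
  have down: "ew_le arNN ?F (f_down (replicate n m))"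
  proof (cases m)
    case 0
    \<comment> \<open>Without children no chain exists, but only one forest has the right degree,
      and it is the common value of both bounds.\<close>
    have W: "W = replicate n (Node 0 [])"
      using ary_trees_0_forest[of W] assms True 0 by simp
    have "?F = f_down (replicate n m)"
      unfolding 0 f_down_replicate_0 W
      by (simp add: f_up_def corolla_def arNN_def)
    then show ?thesis by (simp add: ew_le_def)
  next
    case (Suc a)
    then show ?thesis using ew_le_f_down_Suc[OF F] dc by simp
  qed
  have "map_sterm Inl U = (Leaf :: (nat + nat) sterm) \<longleftrightarrow> U = Leaf" for U :: "nat sterm"
    by (cases U) auto
  then have "ew_le arNN (f_up (replicate n m)) ?F \<longleftrightarrow> sparse (W @ [Leaf])"
    unfolding f_up_ew_le_iff[OF F dc] using sparse_iff_nonleaf[of W] True assms(2)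
    by (simp add: take_map comp_def)
  with F down True show ?thesis by (simp add: fuss_catalan_ew_def)
next
  case False
  have "dc (f_up (replicate n m)) \<noteq> dc ?F"
    using False by (simp add: f_up_replicate dc_forest[OF assms(1)] del: dc.simps)
  with False show ?thesis by (auto simp: fuss_catalan_ew_def ew_le_def)
qed

lemma fuss_catalan_ew_eq:
  "fuss_catalan_ew m n = (\<lambda>W. Node (Inr n) (map (map_sterm Inl) W)) `
    {W. set W \<subseteq> ary_trees m \<and> length W = n \<and> sum_list (map deg W) = n \<and> sparse (W @ [Leaf])}"
    (is "_ = ?f ` ?W")
proof -
  have *: "\<exists>W. set W \<subseteq> ary_trees m \<and> length W = n \<and> F = Node (Inr n) (map (map_sterm Inl) W)"
    if "F \<in> fuss_catalan_ew m n" for F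
  proof -
    \<comment> \<open>Comparability with \<open>f_up\<close> fixes the decoration word, hence the
      root symbol \<open>Inr n\<close> and the letter \<open>Inl m\<close> everywhere below.\<close>
    have F: "F \<in> terms UNIV arNN" "dc F = Inr n # replicate n (Inl m)"
      using that by (simp_all add: fuss_catalan_ew_def ew_le_def f_up_replicate(1))
    then obtain ts where ts: "F = Node (Inr n) ts" by (cases F) auto
    have "length ts = n" "\<forall>t\<in>set ts. t \<in> terms UNIV arNN"
      using F(1) by (auto simp: ts arNN_def elim: terms.cases)
    moreover have "set (concat (map dc ts)) \<subseteq> {Inl m}" using F(2) by (simp add: ts set_replicate_conv_if)
    ultimately have "\<forall>t\<in>set ts. \<exists>U\<in>ary_trees m. t = map_sterm Inl U"
      by (auto intro!: ary_trees_map_Inl_exists)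
    then obtain f where f: "\<And>t. t \<in> set ts \<Longrightarrow> f t \<in> ary_trees m \<and> t = map_sterm Inl (f t)"
      by metis
    then have "map (map_sterm Inl) (map f ts) = ts" by (simp add: map_idI)
    with f \<open>length ts = n\<close> show ?thesis
      by (intro exI[of _ "map f ts"]) (auto simp: ts)
  qed
  show ?thesis
  proof (intro equalityI subsetI)
    fix F assume F: "F \<in> fuss_catalan_ew m n"
    with * obtain W where "set W \<subseteq> ary_trees m" "length W = n"
      "F = Node (Inr n) (map (map_sterm Inl) W)" by blast
    with F show "F \<in> ?f ` ?W" using forest_in_fuss_catalan_ew_iff[of W m n] by blast
  next
    fix F assume "F \<in> ?f ` ?W"
    then show "F \<in> fuss_catalan_ew m n" using forest_in_fuss_catalan_ew_iff[of _ m n] by auto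
  qed
qed

theorem theorem4p2p4:
  fixes m n :: nat
  shows "fuss_catalan_ew m n \<approx> {t \<in> m_trees m. deg t = n}
       \<and> bij_betw (iforest \<circ> bt m) {t \<in> m_trees m. deg t = n} (fuss_catalan_ew m n)"
proof -
  let ?T = "{t \<in> m_trees m. deg t = n}"
    and ?f = "\<lambda>W. Node (Inr n) (map (map_sterm Inl) W) :: (nat + nat) sterm"
  have "inj (map_sterm (Inl :: nat \<Rightarrow> nat + nat))" by (simp add: sterm.inj_map)
  then have inj: "inj ?f" by (intro injI) (simp add: inj_map_eq_map)
  have "bij_betw (?f \<circ> code m) ?T (fuss_catalan_ew m n)"
    unfolding fuss_catalan_ew_eq
    by (rule bij_betw_trans[OF bij_betw_code inj_on_imp_bij_betw[OF inj_on_subset[OF inj subset_UNIV]]])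
  \<comment> \<open>On \<open>?T\<close> the root symbol \<open>Inr (deg t)\<close> from
    \<open>iforest_bt\<close> is the constant \<open>Inr n\<close>.\<close>
  then have "bij_betw (iforest \<circ> bt m) ?T (fuss_catalan_ew m n)"
    by (rule iffD1[OF bij_betw_cong, rotated]) (auto simp: iforest_bt)
  moreover from this have "?T \<approx> fuss_catalan_ew m n" unfolding eqpoll_def by blast
  ultimately show ?thesis by (simp add: eqpoll_sym)
qed

end
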